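(* Let $\mathcal{X}=\prod_{i=1}^n\mathcal{X}_i$ where each $\mathcal{X}_i\subset\mathbb{R}$ is a compact interval, and let $F:\mathcal{X}\to\mathbb{R}$ be a normalized function that is differentiable on $\mathcal{X}$. Suppose there exists $L_F\ge 0$ such that $$\frac{\partial F}{\partial x_i}(x)-\frac{\partial F}{\partial x_i}(x+a e_j)\ \ge\ -L_F\,a$$ for all $x\in\mathcal{X}$, all $i\neq j$ in $\{1,\dots,n\}$, and all $a>0$ with $x_j+a\in\mathcal{X}_j$. Then there exist normalized submodular functions $G,H:\mathcal{X}\to\mathbb{R}$ such that $F=G-H$. Moreover, $G$ and $H$ can be chosen to be normalized and strictly submodular.
   Context: $e_j$ denotes the $j$-th standard basis vector of $\mathbb{R}^n$. "Differentiable on $\mathcal{X}$" means differentiable on an open set containing $\mathcal{X}$. $x\le y$ means $x_i\le y_i$ for all $i$, and $\min\{x,y\}$, $\max\{x,y\}$ are taken componentwise. Let $x^{\min}$ be the smallest element of $\mathcal{X}$. A function $F:\mathcal{X}\to\mathbb{R}$ is normalized if $F(x^{\min})=0$. It is submodular if $F(x)+F(y)\ge F(\min\{x,y\})+F(\max\{x,y\})$ for all $x,y\in\mathcal{X}$, and strictly submodular if this inequality is strict whenever $x$ and $y$ are not comparable (neither $x\le y$ nor $y\le x$). *)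

theory Defs
  imports "HOL-Analysis.Analysis"
begin

text \<open>
  On \<^typ>\<open>real^'n\<close> the library's \<^term>\<open>(\<le>)\<close>, \<^term>\<open>inf\<close> and \<^term>\<open>sup\<close> are the componentwise order,
  minimum and maximum. A function \<open>X \<rightarrow> \<real>\<close> is represented by a total function of which only the
  values on \<open>X\<close> matter; for a function differentiable on an open neighbourhood of \<open>X\<close>, the total
  function also carries the extension to that neighbourhood.
\<close>

definition interval_product :: "('n::finite \<Rightarrow> real set) \<Rightarrow> (real^'n) set" where
  "interval_product Xs = {x. \<forall>i. x $ i \<in> Xs i}"

definition partial_deriv :: "(real^'n::finite \<Rightarrow> real) \<Rightarrow> 'n \<Rightarrow> real^'n \<Rightarrow> real" where
  "partial_deriv F i x = deriv (\<lambda>t. F (x + t *\<^sub>R axis i 1)) 0"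

definition normalized_on :: "(real^'n::finite) set \<Rightarrow> (real^'n \<Rightarrow> real) \<Rightarrow> bool" where
  "normalized_on X F \<longleftrightarrow> F (LEAST x. x \<in> X) = 0"

definition submodular_on :: "(real^'n::finite) set \<Rightarrow> (real^'n \<Rightarrow> real) \<Rightarrow> bool" where
  "submodular_on X F \<longleftrightarrow> (\<forall>x\<in>X. \<forall>y\<in>X. F x + F y \<ge> F (inf x y) + F (sup x y))"

definition strictly_submodular_on :: "(real^'n::finite) set \<Rightarrow> (real^'n \<Rightarrow> real) \<Rightarrow> bool" where
  "strictly_submodular_on X F \<longleftrightarrow> submodular_on X F \<and>
     (\<forall>x\<in>X. \<forall>y\<in>X. \<not> x \<le> y \<and> \<not> y \<le> x \<longrightarrow> F x + F y > F (inf x y) + F (sup x y))"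

end

theory Submission
  imports Defs
begin

text \<open>
  The hypothesis says, in integrated form, that the mixed second differences of \<open>F\<close> are bounded:
  if \<open>u, v \<ge> 0\<close> have disjoint supports and \<open>z, z + u + v \<in> X\<close>, then
  \<open>F (z + u) + F (z + v) - F z - F (z + u + v) \<ge> - L \<sigma>(u) \<sigma>(v)\<close>, where \<open>\<sigma>\<close> is the sum of the
  coordinates (lemma \<open>second_difference_lower_bound\<close>). Taking \<open>z = inf x y\<close>,
  \<open>u = x - inf x y\<close> and \<open>v = y - inf x y\<close> makes the left-hand side the submodularity gap
  \<open>F x + F y - F (inf x y) - F (sup x y)\<close>, so \<open>F\<close> fails to be submodular by at most
  \<open>L \<sigma>(u) \<sigma>(v)\<close>.

  The concave quadratic \<open>- (c / 2) \<sigma>\<^sup>2\<close> has second difference exactly \<open>c \<sigma>(u) \<sigma>(v)\<close>, hence it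
  is strictly submodular for \<open>c > 0\<close>: both factors are positive when \<open>x\<close> and \<open>y\<close> are not
  comparable. With \<open>c = L + 1\<close> its gap exceeds the defect of \<open>F\<close>, so \<open>H = - (c / 2) \<sigma>\<^sup>2\<close> and
  \<open>G = F + H\<close> are both strictly submodular. Shifting \<open>H\<close> by a constant normalizes both.
\<close>

definition coord_sum :: "real^'n::finite \<Rightarrow> real" where
  "coord_sum x = (\<Sum>i\<in>UNIV. x $ i)"

lemma coord_sum_add: "coord_sum (x + y) = coord_sum x + coord_sum y"
  by (simp add: coord_sum_def sum.distrib)

lemma coord_sum_pos:
  assumes "0 \<le> x" "x \<noteq> 0"
  shows "0 < coord_sum x"
proof -
  obtain i where "x $ i \<noteq> 0"
    using assms(2) by (auto simp: vec_eq_iff)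
  with assms(1) have "0 < x $ i"
    by (simp add: less_eq_vec_def order_less_le)
  then show ?thesis
    unfolding coord_sum_def using assms(1) by (intro sum_pos2) (auto simp: less_eq_vec_def)
qed

lemma interval_product_order_convex:
  assumes "\<And>i. is_interval (Xs i)" "a \<in> interval_product Xs" "b \<in> interval_product Xs"
    and "a \<le> x" "x \<le> b"
  shows "x \<in> interval_product Xs"
  using assms unfolding interval_product_def less_eq_vec_def
  by (auto intro: mem_is_interval_1_I)

lemma interval_product_inf_sup:
  assumes "x \<in> interval_product Xs" "y \<in> interval_product Xs"
  shows "inf x y \<in> interval_product Xs" "sup x y \<in> interval_product Xs"
  using assms by (auto simp: interval_product_def inf_vec_def sup_vec_def inf_real_def sup_real_def
      min_def max_def)

text \<open>
  Every pair is two corners of a box, with \<open>inf x y\<close> and \<open>sup x y\<close> the other two, whose edge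
  vectors \<open>u\<close> and \<open>v\<close> never move the same coordinate. This turns the submodularity gap into a
  mixed second difference.
\<close>

lemma inf_sup_box:
  fixes x y :: "real^'n::finite"
  defines "u \<equiv> x - inf x y" and "v \<equiv> y - inf x y"
  shows "0 \<le> u" "0 \<le> v" "x = inf x y + u" "y = inf x y + v" "sup x y = inf x y + u + v"
    and "u $ i = 0 \<or> v $ i = 0"
    and "\<not> x \<le> y \<Longrightarrow> u \<noteq> 0" "\<not> y \<le> x \<Longrightarrow> v \<noteq> 0"
proof -
  show "sup x y = inf x y + u + v"
    by (auto simp: u_def v_def vec_eq_iff inf_vec_def sup_vec_def inf_real_def sup_real_def
        min_def max_def)
  show "u $ i = 0 \<or> v $ i = 0"
    by (auto simp: u_def v_def inf_vec_def inf_real_def min_def)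
  show "\<not> x \<le> y \<Longrightarrow> u \<noteq> 0" "\<not> y \<le> x \<Longrightarrow> v \<noteq> 0"
    by (auto simp: u_def v_def le_iff_inf inf_commute)
qed (auto simp: u_def v_def)

lemma has_field_derivative_along_line:
  fixes F :: "'a::real_normed_vector \<Rightarrow> real"
  assumes "(F has_derivative F') (at (q + t *\<^sub>R u))"
  shows "((\<lambda>t. F (q + t *\<^sub>R u)) has_field_derivative F' u) (at t)"
proof -
  interpret F': bounded_linear F'
    using assms by (rule has_derivative_bounded_linear)
  have "((\<lambda>t. q + t *\<^sub>R u) has_derivative (\<lambda>t. t *\<^sub>R u)) (at t)"
    by (auto intro!: derivative_eq_intros)
  then have "((\<lambda>t. F (q + t *\<^sub>R u)) has_derivative (\<lambda>s. F' (s *\<^sub>R u))) (at t)"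
    using assms by (rule has_derivative_compose)
  then show ?thesis
    by (simp add: has_field_derivative_def F'.scaleR mult_commute_abs)
qed

lemma has_derivative_partial_deriv:
  assumes "(F has_derivative F') (at x)"
  shows "F' u = (\<Sum>i\<in>UNIV. u $ i * partial_deriv F i x)"
proof -
  interpret F': bounded_linear F'
    using assms by (rule has_derivative_bounded_linear)
  have partial: "partial_deriv F i x = F' (axis i 1)" for i
    unfolding partial_deriv_def
    by (rule DERIV_imp_deriv, rule has_field_derivative_along_line) (simp add: assms)
  have "u = (\<Sum>i\<in>UNIV. u $ i *\<^sub>R axis i 1)"
    by (simp add: vec_eq_iff axis_def if_distrib cong: if_cong)
  then have "F' u = F' (\<Sum>i\<in>UNIV. u $ i *\<^sub>R axis i 1)"
    by (rule arg_cong)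
  then show ?thesis
    by (simp add: F'.sum F'.scaleR partial)
qed

text \<open>
  The one-coordinate bounds telescope: moving from \<open>x\<close> to \<open>x + v\<close> one coordinate at a time
  stays inside the product of intervals by order convexity, and the bound applies at each step because coordinate
  \<open>i\<close> is never moved.
\<close>

lemma partial_deriv_difference_lower_bound:
  assumes intervals: "\<And>i. is_interval (Xs i)"
    and bound: "\<And>x i j a. \<lbrakk>x \<in> interval_product Xs; i \<noteq> j; 0 < a; x $ j + a \<in> Xs j\<rbrakk> \<Longrightarrow>
      partial_deriv F i x - partial_deriv F i (x + a *\<^sub>R axis j 1) \<ge> - L * a"
    and x: "x \<in> interval_product Xs" "x + v \<in> interval_product Xs" and v: "0 \<le> v" "v $ i = 0"
  shows "partial_deriv F i x - partial_deriv F i (x + v) \<ge> - L * coord_sum v"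
proof -
  define w where "w A = (\<chi> j. if j \<in> A then v $ j else 0)" for A
  have "partial_deriv F i x - partial_deriv F i (x + w A) \<ge> - L * sum (($) v) A" for A
  proof (induction A rule: finite_induct[OF finite])
    case 1
    then show ?case
      by (simp add: w_def flip: zero_vec_def)
  next
    case (2 j A)
    have step: "w (insert j A) = w A + v $ j *\<^sub>R axis j 1"
      using 2(2) by (auto simp: w_def vec_eq_iff axis_def)
    have "partial_deriv F i (x + w A) - partial_deriv F i (x + w (insert j A)) \<ge> - L * v $ j"
    proof (cases "v $ j = 0")
      case True
      then show ?thesis
        by (simp add: step)
    next
      case False
      then have "0 < v $ j" "i \<noteq> j"
        using v by (auto simp: less_eq_vec_def order_less_le)
      moreover have "x + w A \<in> interval_product Xs"
        by (rule interval_product_order_convex[OF intervals x])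
          (use v(1) in \<open>auto simp: w_def less_eq_vec_def\<close>)
      moreover have "(x + w A) $ j + v $ j \<in> Xs j"
        using x(2) 2(2) by (simp add: w_def interval_product_def)
      ultimately show ?thesis
        using bound[of "x + w A" i j "v $ j"] by (simp add: step add.assoc)
    qed
    then show ?case
      using 2 by (simp add: algebra_simps)
  qed
  from this[of UNIV] show ?thesis
    by (simp add: w_def coord_sum_def)
qed

text \<open>
  The derivative of \<open>F (z + t u) - F (z + t u + v)\<close> in \<open>t\<close> is the combination, with
  weights \<open>u $ i\<close>, of differences of partial derivatives along \<open>v\<close>. A positive weight forces
  \<open>v $ i = 0\<close>, so each difference is at least \<open>- L \<sigma>(v)\<close> and the derivative is at
  least \<open>- L \<sigma>(u) \<sigma>(v)\<close>. Adding \<open>L \<sigma>(u) \<sigma>(v) t\<close> thus gives a nondecreasing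
  function, and the claim compares its values at \<open>t = 0\<close> and \<open>t = 1\<close>.
\<close>

lemma second_difference_lower_bound:
  fixes F :: "real^'n::finite \<Rightarrow> real"
  assumes intervals: "\<And>i. is_interval (Xs i)"
    and differentiable: "\<And>x. x \<in> interval_product Xs \<Longrightarrow> F differentiable (at x)"
    and bound: "\<And>x i j a. \<lbrakk>x \<in> interval_product Xs; i \<noteq> j; 0 < a; x $ j + a \<in> Xs j\<rbrakk> \<Longrightarrow>
      partial_deriv F i x - partial_deriv F i (x + a *\<^sub>R axis j 1) \<ge> - L * a"
    and z: "z \<in> interval_product Xs" "z + u + v \<in> interval_product Xs"
    and nonneg: "0 \<le> u" "0 \<le> v" and disjoint: "\<And>i. u $ i = 0 \<or> v $ i = 0"
  shows "F (z + u) + F (z + v) - F z - F (z + u + v) \<ge> - L * coord_sum u * coord_sum v"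
proof -
  let ?c = "L * coord_sum u * coord_sum v"
  define \<psi> where "\<psi> t = F (z + t *\<^sub>R u) - F (z + v + t *\<^sub>R u) + ?c * t" for t
  have "\<psi> 0 \<le> \<psi> 1"
  proof (rule DERIV_nonneg_imp_nondecreasing[where f = \<psi>])
    fix t :: real
    assume t: "0 \<le> t" "t \<le> 1"
    define p where "p = z + t *\<^sub>R u"
    have tu: "0 \<le> t * u $ i" "t * u $ i \<le> u $ i" for i
      using t nonneg by (auto simp: less_eq_vec_def mult_left_le_one_le)
    have p: "p \<in> interval_product Xs" "p + v \<in> interval_product Xs"
      by (rule interval_product_order_convex[OF intervals z];
          use tu nonneg in \<open>auto simp: p_def less_eq_vec_def intro: add_increasing2\<close>)+
    obtain D E where D: "(F has_derivative D) (at p)" and E: "(F has_derivative E) (at (p + v))"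
      using differentiable p unfolding differentiable_def by blast
    have 1: "((\<lambda>t. F (z + t *\<^sub>R u)) has_field_derivative D u) (at t)"
      using D unfolding p_def by (rule has_field_derivative_along_line)
    have "p + v = z + v + t *\<^sub>R u"
      by (simp add: p_def)
    with E have 2: "((\<lambda>t. F (z + v + t *\<^sub>R u)) has_field_derivative E u) (at t)"
      by (intro has_field_derivative_along_line) simp
    have \<psi>': "(\<psi> has_field_derivative D u - E u + ?c) (at t)"
      unfolding \<psi>_def by (intro DERIV_add DERIV_diff 1 2 DERIV_cmult_Id)
    have "u $ i * (- L * coord_sum v) \<le> u $ i * (partial_deriv F i p - partial_deriv F i (p + v))"
      for i
    proof (cases "u $ i = 0")
      case False
      then have "v $ i = 0"
        using disjoint by blast
      then have "- L * coord_sum v \<le> partial_deriv F i p - partial_deriv F i (p + v)"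
        using intervals bound p nonneg(2) by (intro partial_deriv_difference_lower_bound)
      then show ?thesis
        using nonneg(1) by (intro mult_left_mono) (auto simp: less_eq_vec_def)
    qed simp
    then have "(\<Sum>i\<in>UNIV. u $ i * (- L * coord_sum v))
        \<le> (\<Sum>i\<in>UNIV. u $ i * (partial_deriv F i p - partial_deriv F i (p + v)))"
      by (intro sum_mono)
    also have "\<dots> = D u - E u"
      unfolding has_derivative_partial_deriv[OF D] has_derivative_partial_deriv[OF E]
      by (simp add: right_diff_distrib sum_subtractf)
    also have "(\<Sum>i\<in>UNIV. u $ i * (- L * coord_sum v)) = - ?c"
      by (simp add: coord_sum_def[of u] sum_distrib_left sum_distrib_right sum_negf mult_ac)
    finally have "- ?c \<le> D u - E u" .
    with \<psi>' show "\<exists>y. (\<psi> has_field_derivative y) (at t) \<and> y \<ge> 0"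
      by (intro exI[of _ "D u - E u + ?c"]) simp
  qed simp
  then show ?thesis
    by (simp add: \<psi>_def add_ac)
qed

lemma strictly_submodular_onI:
  assumes "\<And>x y. \<lbrakk>x \<in> X; y \<in> X; \<not> x \<le> y; \<not> y \<le> x\<rbrakk> \<Longrightarrow> F (inf x y) + F (sup x y) < F x + F y"
  shows "strictly_submodular_on X F"
proof -
  have "F (inf x y) + F (sup x y) \<le> F x + F y" if "x \<in> X" "y \<in> X" for x y
  proof (cases "x \<le> y \<or> y \<le> x")
    case True
    then show ?thesis
      by (auto simp: inf_absorb1 inf_absorb2 sup_absorb1 sup_absorb2)
  next
    case False
    then show ?thesis
      using assms[OF that] by simp
  qed
  then show ?thesis
    using assms by (auto simp: strictly_submodular_on_def submodular_on_def)
qed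

lemma coord_sum_square_second_difference:
  "(coord_sum (z + u + v))\<^sup>2 + (coord_sum z)\<^sup>2 - (coord_sum (z + u))\<^sup>2 - (coord_sum (z + v))\<^sup>2
    = 2 * coord_sum u * coord_sum v"
  by (simp add: coord_sum_add power2_eq_square algebra_simps)

theorem proposition3p3:
  fixes Xs :: "'n::finite \<Rightarrow> real set"
    and X :: "(real^'n) set"
    and F :: "real^'n \<Rightarrow> real"
  assumes intervals: "\<And>i. is_interval (Xs i) \<and> compact (Xs i) \<and> Xs i \<noteq> {}"
    and X: "X = interval_product Xs"
    and normalized: "normalized_on X F"
    and differentiable: "\<exists>U. open U \<and> X \<subseteq> U \<and> F differentiable_on U"
    and bound: "\<exists>L\<ge>0. \<forall>x\<in>X. \<forall>i j. i \<noteq> j \<longrightarrow> (\<forall>a>0. x $ j + a \<in> Xs j \<longrightarrow>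
      partial_deriv F i x - partial_deriv F i (x + a *\<^sub>R axis j 1) \<ge> - L * a)"
  shows "(\<exists>G H. normalized_on X G \<and> submodular_on X G \<and>
            normalized_on X H \<and> submodular_on X H \<and> (\<forall>x\<in>X. F x = G x - H x)) \<and>
         (\<exists>G H. normalized_on X G \<and> strictly_submodular_on X G \<and>
            normalized_on X H \<and> strictly_submodular_on X H \<and> (\<forall>x\<in>X. F x = G x - H x))"
proof -
  obtain U where U: "open U" "X \<subseteq> U" "F differentiable_on U"
    using differentiable by blast
  have diff: "F differentiable (at x)" if "x \<in> X" for x
    using U that by (metis at_within_open differentiable_on_def subsetD)
  from bound obtain L where "0 \<le> L" and L: "\<forall>x\<in>X. \<forall>i j. i \<noteq> j \<longrightarrow> (\<forall>a>0. x $ j + a \<in> Xs j \<longrightarrow>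
      partial_deriv F i x - partial_deriv F i (x + a *\<^sub>R axis j 1) \<ge> - L * a)"
    by (elim exE conjE)
  define m where "m = (LEAST x. x \<in> X)"
  define H where "H x = (L + 1) / 2 * ((coord_sum m)\<^sup>2 - (coord_sum x)\<^sup>2)" for x :: "real^'n"
  define G where "G x = F x + H x" for x
  have norm: "normalized_on X G" "normalized_on X H"
    using normalized by (auto simp: normalized_on_def G_def H_def m_def)
  have gaps: "H (inf x y) + H (sup x y) < H x + H y \<and> G (inf x y) + G (sup x y) < G x + G y"
    if xy: "x \<in> X" "y \<in> X" "\<not> x \<le> y" "\<not> y \<le> x" for x y
  proof -
    define z u v where "z = inf x y" and "u = x - inf x y" and "v = y - inf x y"
    note box = inf_sup_box[where x = x and y = y, folded u_def v_def, folded z_def]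
    have corners: "z + u = x" "z + v = y" "x + v = sup x y"
      using box(3-5) by auto
    have pos: "0 < coord_sum u * coord_sum v"
      using box(1,2,7,8) xy(3,4) by (intro mult_pos_pos coord_sum_pos)
    have "F (z + u) + F (z + v) - F z - F (z + u + v) \<ge> - L * coord_sum u * coord_sum v"
    proof (rule second_difference_lower_bound)
      show "z \<in> interval_product Xs" "z + u + v \<in> interval_product Xs"
        using interval_product_inf_sup[of x Xs y] xy(1,2) X corners by (auto simp: z_def)
    qed (use intervals diff L X box(1,2,6) in auto)
    then have F: "F x + F y - F (inf x y) - F (sup x y) \<ge> - L * (coord_sum u * coord_sum v)"
      unfolding corners by (simp add: z_def mult.assoc)
    have "H x + H y - H z - H (sup x y) = (L + 1) / 2 * ((coord_sum (sup x y))\<^sup>2 +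
        (coord_sum z)\<^sup>2 - (coord_sum x)\<^sup>2 - (coord_sum y)\<^sup>2)"
      by (simp add: H_def algebra_simps)
    also have "\<dots> = (L + 1) / 2 * (2 * coord_sum u * coord_sum v)"
      using coord_sum_square_second_difference[of z u v] unfolding corners by simp
    finally have H: "H x + H y - H (inf x y) - H (sup x y)
        = L * (coord_sum u * coord_sum v) + coord_sum u * coord_sum v"
      by (simp add: z_def algebra_simps)
    have "0 \<le> L * (coord_sum u * coord_sum v)"
      using \<open>0 \<le> L\<close> pos by simp
    with F H pos show ?thesis
      unfolding G_def by linarith
  qed
  have strict: "strictly_submodular_on X G" "strictly_submodular_on X H"
    using gaps by (auto intro!: strictly_submodular_onI)
  have FGH: "\<forall>x\<in>X. F x = G x - H x"
    by (simp add: G_def)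
  show ?thesis
    using norm strict FGH unfolding strictly_submodular_on_def by blast
qed

end
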